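(* Let $k\ge 2$ and $r\ge 2$ be integers, let $0<p\le (r-1)/r$ and $q=1-p$. Let $f$ be the quadratic polynomial $$f(v)=-qp^k v^2+\Big(p^k\big[q-(kq+q+1)(r-1)\big]+r-1\Big)v+(r-1)\Big\{(r-1)\big(1-p^k(1+kq)\big)+p^k(k+q)-\frac{1-p^k}{q}\Big\},$$ and let $v_2$ be its largest real root. Put $\rho=v_2$ if $v_2>k$ and $\rho=k$ if $v_2\le k$. Then every mode $m=m_k(r,p)$ of the negative binomial distribution of order $k$, type I, with parameters $r$ and $p$ satisfies $$m\;\ge\; kr+\lfloor \rho\rfloor .$$
   Context: For positive integers $k,r$ and $0<p<1$, $q=1-p$, an integer-valued random variable $X$ has the negative binomial distribution of order $k$, type I, with parameters $r$ and $p$, if its probability mass function is $$P_n=P(X=n)=p^n\sum \binom{n_1+n_2+\cdots+n_k+r-1}{n_1,\,n_2,\ldots,n_k,\,r-1}\left(\frac{q}{p}\right)^{n_1+n_2+\cdots+n_k}\quad (n\ge kr),$$ and $P_n=0$ for $n<kr$, where the sum is over all $k$-tuples of non-negative integers $(n_1,\ldots,n_k)$ with $n_1+2n_2+\cdots+kn_k=n-kr$, and $\binom{N}{a_1,\ldots,a_{k+1}}=\frac{N!}{a_1!\cdots a_{k+1}!}$ denotes the multinomial coefficient. A mode $m_k(r,p)$ of this distribution is an integer $n$ at which $P_n$ attains its maximum (there may be several). $\lfloor x\rfloor$ denotes the greatest integer not exceeding $x$.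
   Formalization: The single case k = r = 2, p = 1/2 is excluded, because the claim fails there: f has largest root 3, so the bound would be m ≥ 7, but P_6 = P_7 = P_8 = 5/64 is the maximum, so 6 is a mode. *)

theory Defs
  imports Complex_Main "HOL-Library.FuncSet" "HOL-Number_Theory.Fib"
begin

definition weighted_tuples :: "nat \<Rightarrow> nat \<Rightarrow> (nat \<Rightarrow> nat) set" where
  "weighted_tuples k s = {\<nu> \<in> {1..k} \<rightarrow>\<^sub>E UNIV. (\<Sum>i=1..k. i * \<nu> i) = s}"

text \<open>The quotient of factorials is the multinomial coefficient with lower entries
  \<open>\<nu> 1, \<dots>, \<nu> k, r - 1\<close>.\<close>

definition negbin_order_pmf :: "nat \<Rightarrow> nat \<Rightarrow> real \<Rightarrow> int \<Rightarrow> real" where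
  "negbin_order_pmf k r p n =
     (if n < int (k * r) then 0
      else p ^ nat n *
        (\<Sum>\<nu> \<in> weighted_tuples k (nat n - k * r).
           fact ((\<Sum>i=1..k. \<nu> i) + (r - 1)) / ((\<Prod>i=1..k. fact (\<nu> i)) * fact (r - 1))
           * ((1 - p) / p) ^ (\<Sum>i=1..k. \<nu> i)))"

definition is_mode :: "(int \<Rightarrow> real) \<Rightarrow> int \<Rightarrow> bool" where
  "is_mode P m \<longleftrightarrow> (\<forall>n. P n \<le> P m)"

definition mode_quadratic :: "nat \<Rightarrow> nat \<Rightarrow> real \<Rightarrow> real \<Rightarrow> real" where
  "mode_quadratic k r p v = (let q = 1 - p; t = real r - 1 in
     - q * p ^ k * v\<^sup>2
     + (p ^ k * (q - (real k * q + q + 1) * t) + t) * v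
     + t * (t * (1 - p ^ k * (1 + real k * q)) + p ^ k * (real k + q) - (1 - p ^ k) / q))"

definition is_largest_root :: "(real \<Rightarrow> real) \<Rightarrow> real \<Rightarrow> bool" where
  "is_largest_root f v \<longleftrightarrow> f v = 0 \<and> (\<forall>x. f x = 0 \<longrightarrow> x \<le> v)"

text \<open>For \<open>k = r = 2\<close> and \<open>p = 1/2\<close> the largest root is \<open>3 > k\<close>, while the maximum of the mass function
  is attained at \<open>6\<close>, \<open>7\<close> and \<open>8\<close>. So the mode \<open>6\<close> lies below \<open>k r + 3 = 7\<close>, and the bound on
  all modes needs this parameter triple to be excluded.\<close>

lemma largest_root_2_2_half: "is_largest_root (mode_quadratic 2 2 (1/2)) 3"
proof -
  have eq: "mode_quadratic 2 2 (1/2) v = - ((v - 1) * (v - 3)) / 8" for v :: real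
    by (simp add: mode_quadratic_def Let_def power2_eq_square field_simps)
  show ?thesis unfolding is_largest_root_def eq by auto
qed

lemma weighted_tuples_2:
  "bij_betw (\<lambda>j. \<lambda>i\<in>{1..2::nat}. if i = 1 then s - 2 * j else j) {j. 2 * j \<le> s} (weighted_tuples 2 s)"
proof (rule bij_betw_byWitness[where f' = "\<lambda>\<nu>. \<nu> 2"])
  have *: "{Suc 0..2} = {Suc 0, 2}" by auto
  show "\<forall>a\<in>{j. 2 * j \<le> s}. (\<lambda>i\<in>{1..2::nat}. if i = 1 then s - 2 * a else a) 2 = a" by simp
  show "\<forall>a'\<in>weighted_tuples 2 s. (\<lambda>i\<in>{1..2::nat}. if i = 1 then s - 2 * a' 2 else a' 2) = a'"
    by (auto simp: weighted_tuples_def * fun_eq_iff PiE_def extensional_def)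
  show "(\<lambda>j. \<lambda>i\<in>{1..2::nat}. if i = 1 then s - 2 * j else j) ` {j. 2 * j \<le> s} \<subseteq> weighted_tuples 2 s"
    by (auto simp: weighted_tuples_def * split: if_splits)
  show "(\<lambda>\<nu>. \<nu> 2) ` weighted_tuples 2 s \<subseteq> {j. 2 * j \<le> s}"
    by (auto simp: weighted_tuples_def *)
qed

lemma negbin_order_pmf_2_2_half:
  "negbin_order_pmf 2 2 (1/2) (4 + int s) =
     (1/2) ^ (4 + s) * (\<Sum>j = 0..s. real ((s - j + 1) * ((s - j) choose j)))"
proof -
  have *: "{Suc 0..2} = {Suc 0, 2}" by auto
  let ?F = "\<lambda>\<nu>. fact ((\<Sum>i=1..2. \<nu> i) + (2 - 1)) / ((\<Prod>i=1..2. fact (\<nu> i)) * fact (2 - 1))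
              * ((1 - 1/2) / (1/2)) ^ (\<Sum>i=1..2. \<nu> i) :: real"
  have n: "nat (4 + int s) = 4 + s" by simp
  have "(\<Sum>\<nu> \<in> weighted_tuples 2 s. ?F \<nu>)
      = (\<Sum>j | 2 * j \<le> s. ?F (\<lambda>i\<in>{1..2::nat}. if i = 1 then s - 2 * j else j))"
    by (rule sum.reindex_bij_betw[OF weighted_tuples_2, symmetric])
  also have "\<dots> = (\<Sum>j | 2 * j \<le> s. real ((s - j + 1) * ((s - j) choose j)))"
  proof (rule sum.cong[OF refl])
    fix j assume "j \<in> {j. 2 * j \<le> s}"
    then have j: "2 * j \<le> s" by simp
    have e: "s - 2 * j + j = s - j" "s - j - j = s - 2 * j" "j \<le> s - j" using j by auto
    have "fact (s - j) = fact (s - 2 * j) * fact j * real ((s - j) choose j)"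
      using binomial_fact[OF e(3), where 'a = real] unfolding e(2) by simp
    then have "fact (s - j + 1) / (fact (s - 2 * j) * fact j) = real ((s - j + 1) * ((s - j) choose j))"
      by (simp add: field_simps)
    then show "?F (\<lambda>i\<in>{1..2::nat}. if i = 1 then s - 2 * j else j) = real ((s - j + 1) * ((s - j) choose j))"
      by (simp add: * e(1) del: of_nat_Suc of_nat_mult fact_Suc)
  qed
  also have "\<dots> = (\<Sum>j = 0..s. real ((s - j + 1) * ((s - j) choose j)))"
  proof (rule sum.mono_neutral_left)
    show "\<forall>j\<in>{0..s} - {j. 2 * j \<le> s}. real ((s - j + 1) * ((s - j) choose j)) = 0"
    proof
      fix j assume "j \<in> {0..s} - {j. 2 * j \<le> s}"
      then have "s - j < j" by auto
      then show "real ((s - j + 1) * ((s - j) choose j)) = 0" by (simp add: binomial_eq_0)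
    qed
  qed auto
  finally show ?thesis by (simp add: negbin_order_pmf_def n)
qed

lemma fib_le_pow2: "(n + 9) * fib (n + 9) \<le> 5 * 2 ^ (n + 6)"
proof (induction n rule: fib.induct)
  case (3 n)
  have eq: "(Suc (Suc n) + 9) * fib (Suc (Suc n) + 9)
      = (n + 11) * (fib (Suc n + 9) + fib (n + 9))"
    using fib.simps(3)[of "n + 9"] by (simp only: add_Suc) simp
  have "4 * ((n + 11) * fib (Suc n + 9)) \<le> 5 * ((Suc n + 9) * fib (Suc n + 9))"
    using mult_right_mono[of "4 * (n + 11)" "5 * (Suc n + 9)" "fib (Suc n + 9)"]
    by (simp only: mult.assoc) simp
  moreover have "4 * ((n + 11) * fib (n + 9)) \<le> 5 * ((n + 9) * fib (n + 9))"
    using mult_right_mono[of "4 * (n + 11)" "5 * (n + 9)" "fib (n + 9)"]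
    by (simp only: mult.assoc) simp
  moreover have "(2::nat) ^ (Suc n + 6) = 2 * 2 ^ (n + 6)" "(2::nat) ^ (Suc (Suc n) + 6) = 4 * 2 ^ (n + 6)"
    by (simp_all add: power_add)
  ultimately have "(n + 11) * fib (Suc n + 9) + (n + 11) * fib (n + 9) \<le> 5 * 2 ^ (Suc (Suc n) + 6)"
    using 3 by linarith
  then show ?case unfolding eq by (simp only: distrib_left)
qed (simp_all add: eval_nat_numeral)

lemma mode_2_2_half: "is_mode (negbin_order_pmf 2 2 (1/2)) 6"
  unfolding is_mode_def
proof
  fix n :: int
  have m: "negbin_order_pmf 2 2 (1/2) 6 = 5/64"
    using negbin_order_pmf_2_2_half[of 2] by (simp add: eval_nat_numeral)
  show "negbin_order_pmf 2 2 (1/2) n \<le> negbin_order_pmf 2 2 (1/2) 6"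
  proof (cases "n < 4")
    case True
    then show ?thesis by (simp add: m negbin_order_pmf_def[of _ _ _ n])
  next
    case False
    define s where "s = nat (n - 4)"
    have n: "n = 4 + int s" using False by (simp add: s_def)
    have main: "negbin_order_pmf 2 2 (1/2) (4 + int s) \<le> 5/64"
    proof (cases "s < 8")
      case True
      then consider "s = 0" | "s = 1" | "s = 2" | "s = 3" | "s = 4" | "s = 5" | "s = 6" | "s = 7"
        by linarith
      then have "(\<Sum>j = 0..s. (s - j + 1) * ((s - j) choose j)) * 64 \<le> 5 * 2 ^ (4 + s)"
        by cases (simp only:, code_simp)+
      then have "real ((\<Sum>j = 0..s. (s - j + 1) * ((s - j) choose j)) * 64) \<le> real (5 * 2 ^ (4 + s))"
        by (rule of_nat_mono)
      then have "real (\<Sum>j = 0..s. (s - j + 1) * ((s - j) choose j)) * 64 \<le> 5 * 2 ^ (4 + s)"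
        by (simp only: of_nat_mult of_nat_power of_nat_numeral)
      then show ?thesis
        by (simp only: negbin_order_pmf_2_2_half of_nat_sum[symmetric])
          (simp add: power_one_over field_simps del: of_nat_sum)
    next
      case False
      then obtain l where l: "s = l + 8" by (metis add.commute le_Suc_ex not_less)
      have "(\<Sum>j = 0..s. (s - j + 1) * ((s - j) choose j)) \<le> (\<Sum>j = 0..s. (s + 1) * ((s - j) choose j))"
        by (intro sum_mono mult_right_mono) auto
      also have "\<dots> = (l + 9) * fib (l + 9)"
        using ne_diagonal_fib[of s] by (simp add: sum_distrib_left[symmetric] l add.commute del: fib.simps)
      also have "\<dots> \<le> 5 * 2 ^ (l + 6)" by (rule fib_le_pow2)
      finally have "real (\<Sum>j = 0..s. (s - j + 1) * ((s - j) choose j)) \<le> real (5 * 2 ^ (l + 6))"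
        by (rule of_nat_mono)
      then have "(1/2) ^ (4 + s) * (\<Sum>j = 0..s. real ((s - j + 1) * ((s - j) choose j)))
          \<le> (1/2) ^ (4 + s) * real (5 * 2 ^ (l + 6))"
        by (intro mult_left_mono) (simp_all only: of_nat_sum, simp)
      also have "\<dots> = 5/64" by (simp add: l power_add power_one_over)
      finally show ?thesis by (simp only: negbin_order_pmf_2_2_half)
    qed
    then show ?thesis by (simp only: n m)
  qed
qed

end

theory Submission
  imports Defs "HOL-Computational_Algebra.Formal_Power_Series"
begin

text \<open>The numbers \<open>S v = P(X = k r + v) / p\<^sup>k\<^sup>r\<close> have the generating function
  \<open>(1 - \<Sum>\<^sub>i q p\<^sup>i\<^sup>-\<^sup>1 z\<^sup>i)\<^sup>-\<^sup>r\<close>, whose differential equation gives a recurrence of length \<open>k\<close> and, the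
  weights being geometric, a formula for the increments of \<open>S\<close>. The increments are positive for
  \<open>2 \<le> v \<le> k\<close>; for \<open>v > k\<close> monotonicity up to \<open>v - 1\<close> bounds
  \<open>v (v - 1) (S v - S (v - 1))\<close> from below by \<open>f v * S (v - k - 1)\<close>. Since \<open>f\<close> is concave,
  \<open>f 1 \<ge> 0\<close> and \<open>f v\<^sub>2 = 0\<close>, the sequence \<open>S\<close> increases up to \<open>\<lfloor>\<rho>\<rfloor>\<close>.\<close>

section \<open>Tuple sums with arbitrary weights and their recurrence\<close>

definition tuple_term :: "nat \<Rightarrow> nat \<Rightarrow> (nat \<Rightarrow> real) \<Rightarrow> (nat \<Rightarrow> nat) \<Rightarrow> real" where
  "tuple_term k r w \<nu> =
     fact ((\<Sum>i=1..k. \<nu> i) + (r - 1)) / ((\<Prod>i=1..k. fact (\<nu> i)) * fact (r - 1))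
     * (\<Prod>i=1..k. w i ^ \<nu> i)"

definition tuple_sum :: "nat \<Rightarrow> nat \<Rightarrow> (nat \<Rightarrow> real) \<Rightarrow> nat \<Rightarrow> real" where
  "tuple_sum k r w v = (\<Sum>\<nu>\<in>weighted_tuples k v. tuple_term k r w \<nu>)"

text \<open>The extra factor is the growth of the numerator factorial when one component is raised
  by 1. For \<open>r \<ge> 1\<close> the generating function is r (1 - W)^(-r-1), with W that of the
  weights.\<close>

definition tuple_sum_size :: "nat \<Rightarrow> nat \<Rightarrow> (nat \<Rightarrow> real) \<Rightarrow> nat \<Rightarrow> real" where
  "tuple_sum_size k r w v =
     (\<Sum>\<nu>\<in>weighted_tuples k v. (real (\<Sum>i=1..k. \<nu> i) + real r) * tuple_term k r w \<nu>)"

lemma weighted_tuples_component: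
  assumes "\<nu> \<in> weighted_tuples k v" "i \<in> {1..k}"
  shows "i * \<nu> i \<le> v"
proof -
  have "i * \<nu> i \<le> (\<Sum>j=1..k. j * \<nu> j)"
    using assms(2) by (intro member_le_sum) auto
  then show ?thesis using assms(1) by (simp add: weighted_tuples_def)
qed

lemma finite_weighted_tuples: "finite (weighted_tuples k v)"
proof (rule finite_subset)
  show "weighted_tuples k v \<subseteq> {1..k} \<rightarrow>\<^sub>E {..v}"
  proof
    fix \<nu> assume \<nu>: "\<nu> \<in> weighted_tuples k v"
    have "\<nu> i \<le> v" if "i \<in> {1..k}" for i
    proof -
      have "\<nu> i \<le> i * \<nu> i" using that by auto
      then show ?thesis using weighted_tuples_component[OF \<nu> that] by linarith
    qed
    then show "\<nu> \<in> {1..k} \<rightarrow>\<^sub>E {..v}"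
      using \<nu> by (auto simp: weighted_tuples_def PiE_def)
  qed
  show "finite ({1..k} \<rightarrow>\<^sub>E {..v})" by (intro finite_PiE) auto
qed

lemma weighted_tuples_0: "weighted_tuples k 0 = {\<lambda>i\<in>{1..k}. 0}"
proof (rule equalityI)
  show "weighted_tuples k 0 \<subseteq> {\<lambda>i\<in>{1..k}. 0}"
  proof
    fix \<nu> assume \<nu>: "\<nu> \<in> weighted_tuples k 0"
    have "\<nu> i = 0" if "i \<in> {1..k}" for i
      using weighted_tuples_component[OF \<nu> that] that by auto
    then show "\<nu> \<in> {\<lambda>i\<in>{1..k}. 0}"
      using \<nu> by (auto simp: weighted_tuples_def fun_eq_iff PiE_def extensional_def)
  qed
qed (auto simp: weighted_tuples_def)

lemma tuple_sum_0: "tuple_sum k r w 0 = 1"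
  by (simp add: tuple_sum_def weighted_tuples_0 tuple_term_def)

text \<open>Raising component \<open>i\<close> contributes a factor \<open>Suc (\<nu> i)\<close> to
  the denominator, \<open>w i\<close> to the weights and N + r to the numerator factorial, N being
  the old total.\<close>

lemma tuple_term_increment:
  assumes i: "i \<in> {1..k}" and r: "r \<ge> 1"
  shows "real (Suc (\<nu> i)) * tuple_term k r w (\<nu>(i := Suc (\<nu> i)))
       = w i * ((real (\<Sum>j=1..k. \<nu> j) + real r) * tuple_term k r w \<nu>)"
proof -
  let ?\<nu> = "\<nu>(i := Suc (\<nu> i))"
  define N where "N = (\<Sum>j=1..k. \<nu> j)"
  have cong: "(\<Sum>j\<in>{1..k}-{i}. ?\<nu> j) = (\<Sum>j\<in>{1..k}-{i}. \<nu> j)"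
       "(\<Prod>j\<in>{1..k}-{i}. fact (?\<nu> j)) = (\<Prod>j\<in>{1..k}-{i}. fact (\<nu> j) :: real)"
       "(\<Prod>j\<in>{1..k}-{i}. w j ^ ?\<nu> j) = (\<Prod>j\<in>{1..k}-{i}. w j ^ \<nu> j)"
    by (auto intro!: sum.cong prod.cong)
  have s: "(\<Sum>j=1..k. ?\<nu> j) = Suc N"
    using i cong(1) sum.remove[of "{1..k}" i ?\<nu>] sum.remove[of "{1..k}" i \<nu>]
    unfolding N_def by simp
  have f: "(\<Prod>j=1..k. fact (?\<nu> j)) = real (Suc (\<nu> i)) * (\<Prod>j=1..k. fact (\<nu> j))"
    using i cong(2) prod.remove[of "{1..k}" i "\<lambda>j. fact (?\<nu> j) :: real"]
      prod.remove[of "{1..k}" i "\<lambda>j. fact (\<nu> j) :: real"]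
    by (simp add: algebra_simps)
  have w: "(\<Prod>j=1..k. w j ^ ?\<nu> j) = w i * (\<Prod>j=1..k. w j ^ \<nu> j)"
    using i cong(3) prod.remove[of "{1..k}" i "\<lambda>j. w j ^ ?\<nu> j"]
      prod.remove[of "{1..k}" i "\<lambda>j. w j ^ \<nu> j"]
    by simp
  have nz: "(\<Prod>j=1..k. fact (\<nu> j) :: real) \<noteq> 0" by simp
  have fa: "fact (Suc N + (r - 1)) = (real N + real r) * fact (N + (r - 1))"
    using r by (cases r) (simp_all add: algebra_simps)
  show ?thesis
    unfolding tuple_term_def s f w fa N_def[symmetric]
    using nz by (simp add: field_simps del: of_nat_Suc)
qed

text \<open>The factor \<open>\<nu> i\<close> discards the tuples with \<open>\<nu> i = 0\<close>;
  the others arise uniquely by raising component \<open>i\<close> of a tuple of weight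
  \<open>v - i\<close>.\<close>

lemma sum_component_tuple_term:
  assumes i: "i \<in> {1..k}" and r: "r \<ge> 1"
  shows "(\<Sum>\<nu>\<in>weighted_tuples k v. real (\<nu> i) * tuple_term k r w \<nu>)
       = (if i \<le> v then w i * tuple_sum_size k r w (v - i) else 0)"
proof (cases "i \<le> v")
  case False
  have "\<nu> i = 0" if "\<nu> \<in> weighted_tuples k v" for \<nu>
  proof (rule ccontr)
    assume "\<nu> i \<noteq> 0"
    then have "i \<le> i * \<nu> i" by simp
    then show False using weighted_tuples_component[OF that i] False by linarith
  qed
  then have "(\<Sum>\<nu>\<in>weighted_tuples k v. real (\<nu> i) * tuple_term k r w \<nu>) = 0"
    by (intro sum.neutral) auto
  then show ?thesis using False by simp
next
  case True
  let ?up = "\<lambda>\<nu> :: nat \<Rightarrow> nat. \<nu>(i := Suc (\<nu> i))"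
  let ?down = "\<lambda>\<nu> :: nat \<Rightarrow> nat. \<nu>(i := \<nu> i - 1)"
  have split: "(\<Sum>j=1..k. j * (\<nu>(i := x)) j) = i * x + (\<Sum>j\<in>{1..k}-{i}. j * \<nu> j)"
    for \<nu> :: "nat \<Rightarrow> nat" and x
  proof -
    have "(\<Sum>j\<in>{1..k}-{i}. j * (\<nu>(i := x)) j) = (\<Sum>j\<in>{1..k}-{i}. j * \<nu> j)"
      by (intro sum.cong) auto
    then show ?thesis using i sum.remove[of "{1..k}" i "\<lambda>j. j * (\<nu>(i := x)) j"] by simp
  qed
  have self: "(\<Sum>j=1..k. j * \<nu> j) = i * \<nu> i + (\<Sum>j\<in>{1..k}-{i}. j * \<nu> j)" for \<nu> :: "nat \<Rightarrow> nat"
    using split[of \<nu> "\<nu> i"] by simp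
  have ext: "\<nu>(i := x) \<in> {1..k} \<rightarrow>\<^sub>E UNIV" if "\<nu> \<in> {1..k} \<rightarrow>\<^sub>E UNIV" for \<nu> :: "nat \<Rightarrow> nat" and x
    using that i by (auto simp: PiE_def extensional_def)
  have bij: "bij_betw ?up (weighted_tuples k (v - i)) {\<nu> \<in> weighted_tuples k v. \<nu> i \<noteq> 0}"
  proof (rule bij_betw_byWitness[where f' = ?down])
    show "?up ` weighted_tuples k (v - i) \<subseteq> {\<nu> \<in> weighted_tuples k v. \<nu> i \<noteq> 0}"
    proof
      fix \<nu>' assume "\<nu>' \<in> ?up ` weighted_tuples k (v - i)"
      then obtain \<nu> where \<nu>: "\<nu> \<in> weighted_tuples k (v - i)" "\<nu>' = ?up \<nu>" by auto
      then have "(\<Sum>j=1..k. j * \<nu>' j) = v"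
        using split[of \<nu> "Suc (\<nu> i)"] self[of \<nu>] True by (simp add: weighted_tuples_def)
      then show "\<nu>' \<in> {\<nu> \<in> weighted_tuples k v. \<nu> i \<noteq> 0}"
        using \<nu> ext[of \<nu> "Suc (\<nu> i)"] by (simp add: weighted_tuples_def)
    qed
    show "?down ` {\<nu> \<in> weighted_tuples k v. \<nu> i \<noteq> 0} \<subseteq> weighted_tuples k (v - i)"
    proof
      fix \<nu>' assume "\<nu>' \<in> ?down ` {\<nu> \<in> weighted_tuples k v. \<nu> i \<noteq> 0}"
      then obtain \<nu> where \<nu>: "\<nu> \<in> weighted_tuples k v" "\<nu> i \<noteq> 0" "\<nu>' = ?down \<nu>" by auto
      then obtain x where x: "\<nu> i = Suc x" using not0_implies_Suc by blast
      have "(\<Sum>j=1..k. j * \<nu>' j) = v - i"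
        using split[of \<nu> x] self[of \<nu>] \<nu> x by (auto simp: weighted_tuples_def)
      then show "\<nu>' \<in> weighted_tuples k (v - i)"
        using \<nu> ext[of \<nu> "\<nu> i - 1"] by (simp add: weighted_tuples_def)
    qed
  qed (auto simp: fun_eq_iff)
  have "(\<Sum>\<nu>\<in>weighted_tuples k v. real (\<nu> i) * tuple_term k r w \<nu>)
      = (\<Sum>\<nu> | \<nu> \<in> weighted_tuples k v \<and> \<nu> i \<noteq> 0. real (\<nu> i) * tuple_term k r w \<nu>)"
    by (rule sum.mono_neutral_right) (auto simp: finite_weighted_tuples)
  also have "\<dots> = (\<Sum>\<nu>\<in>weighted_tuples k (v - i). real (?up \<nu> i) * tuple_term k r w (?up \<nu>))"
    by (rule sum.reindex_bij_betw[OF bij, symmetric])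
  also have "\<dots> = w i * tuple_sum_size k r w (v - i)"
    using tuple_term_increment[OF i r]
    by (simp add: tuple_sum_size_def sum_distrib_left del: of_nat_Suc of_nat_sum)
  finally show ?thesis using True by simp
qed

lemma index_times_tuple_sum:
  assumes "r \<ge> 1"
  shows "real v * tuple_sum k r w v
       = (\<Sum>i=1..k. if i \<le> v then real i * w i * tuple_sum_size k r w (v - i) else 0)"
proof -
  have "real v * tuple_sum k r w v
      = (\<Sum>\<nu>\<in>weighted_tuples k v. \<Sum>i=1..k. real i * (real (\<nu> i) * tuple_term k r w \<nu>))"
    unfolding tuple_sum_def sum_distrib_left
  proof (rule sum.cong[OF refl])
    fix \<nu> assume "\<nu> \<in> weighted_tuples k v"
    then have "real v = (\<Sum>i=1..k. real i * real (\<nu> i))"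
      by (auto simp: weighted_tuples_def)
    then show "real v * tuple_term k r w \<nu>
        = (\<Sum>i=1..k. real i * (real (\<nu> i) * tuple_term k r w \<nu>))"
      by (simp add: sum_distrib_right mult.assoc)
  qed
  also have "\<dots> = (\<Sum>i=1..k. real i * (\<Sum>\<nu>\<in>weighted_tuples k v. real (\<nu> i) * tuple_term k r w \<nu>))"
    by (subst sum.swap) (simp add: sum_distrib_left)
  also have "\<dots> = (\<Sum>i=1..k. if i \<le> v then real i * w i * tuple_sum_size k r w (v - i) else 0)"
    using assms by (intro sum.cong[OF refl]) (simp add: sum_component_tuple_term)
  finally show ?thesis .
qed

lemma tuple_sum_size_rec:
  assumes "r \<ge> 1"
  shows "tuple_sum_size k r w v = real r * tuple_sum k r w v
       + (\<Sum>i=1..k. if i \<le> v then w i * tuple_sum_size k r w (v - i) else 0)"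
proof -
  have "(\<Sum>\<nu>\<in>weighted_tuples k v. real (\<Sum>i=1..k. \<nu> i) * tuple_term k r w \<nu>)
      = (\<Sum>i=1..k. \<Sum>\<nu>\<in>weighted_tuples k v. real (\<nu> i) * tuple_term k r w \<nu>)"
    by (subst sum.swap) (simp add: sum_distrib_right)
  also have "\<dots> = (\<Sum>i=1..k. if i \<le> v then w i * tuple_sum_size k r w (v - i) else 0)"
    using assms by (intro sum.cong[OF refl]) (simp add: sum_component_tuple_term)
  finally show ?thesis
    by (simp add: tuple_sum_size_def tuple_sum_def distrib_right sum.distrib sum_distrib_left)
qed

text \<open>Brings Cauchy products into the window form of the recurrences; the guard keeps the
  truncated difference \<open>v - i\<close> from adding spurious terms at 0.\<close>

lemma fps_mult_truncated_nth:
  fixes c :: "nat \<Rightarrow> 'a::comm_ring_1"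
  shows "fps_nth (Abs_fps (\<lambda>i. if i \<in> {1..k} then c i else 0) * g) v
       = (\<Sum>i=1..k. if i \<le> v then c i * fps_nth g (v - i) else 0)"
proof -
  have "fps_nth (Abs_fps (\<lambda>i. if i \<in> {1..k} then c i else 0) * g) v
      = (\<Sum>i=0..v. if i \<in> {1..k} then c i * fps_nth g (v - i) else 0)"
    unfolding fps_mult_nth by (intro sum.cong) auto
  also have "\<dots> = (\<Sum>i\<in>{0..v} \<inter> {1..k}. c i * fps_nth g (v - i))"
    by (subst sum.inter_restrict) auto
  also have "{0..v} \<inter> {1..k} = {1..k} \<inter> {i. i \<le> v}" by auto
  also have "(\<Sum>i\<in>{1..k} \<inter> {i. i \<le> v}. c i * fps_nth g (v - i))
      = (\<Sum>i=1..k. if i \<le> v then c i * fps_nth g (v - i) else 0)"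
    by (subst sum.inter_restrict) auto
  finally show ?thesis .
qed

text \<open>With \<open>E\<close>, \<open>H\<close> the generating functions of the two tuple sums and \<open>W = \<Sum> w\<^sub>i z\<^sup>i\<close>, the
  preceding identities read \<open>z E' = z W' H\<close> and \<open>H = r E + W H\<close>; eliminating \<open>H\<close> leaves
  \<open>(1 - W) z E' = r z W' E\<close>, the differential equation of \<open>(1 - W)\<^sup>-\<^sup>r\<close>.\<close>

lemma tuple_sum_rec:
  assumes r: "r \<ge> 1"
  shows "real v * tuple_sum k r w v
       = (\<Sum>i=1..k. if i \<le> v then w i * (real v + (real r - 1) * real i) * tuple_sum k r w (v - i) else 0)"
proof -
  define E where "E = Abs_fps (tuple_sum k r w)"
  define H where "H = Abs_fps (tuple_sum_size k r w)"
  define W where "W = Abs_fps (\<lambda>i. if i \<in> {1..k} then w i else 0)"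
  define V where "V = Abs_fps (\<lambda>i. if i \<in> {1..k} then real i * w i else 0)"
  define D where "D = Abs_fps (\<lambda>n. real n * tuple_sum k r w n)"
  have 1: "D = V * H"
    by (rule fps_ext, unfold V_def fps_mult_truncated_nth)
      (simp add: D_def H_def index_times_tuple_sum[OF r] cong: if_cong)
  have 2: "H = fps_const (real r) * E + W * H"
  proof (rule fps_ext)
    fix n
    show "fps_nth H n = fps_nth (fps_const (real r) * E + W * H) n"
      unfolding W_def fps_add_nth fps_mult_truncated_nth
      using tuple_sum_size_rec[OF r, of k w n] by (simp add: H_def E_def cong: if_cong)
  qed
  \<comment> \<open>\<open>H\<close> is eliminated without inverting 1 - W: \<open>D\<close> splits
    into W D and (1 - W) D, and the latter is V (H - W H) = r V E.\<close>
  have "D = W * D + V * (H - W * H)" unfolding 1 by (simp add: algebra_simps)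
  also have "H - W * H = fps_const (real r) * E" using 2 by (simp add: algebra_simps)
  finally have "D = W * D + fps_const (real r) * (V * E)" by (simp add: algebra_simps)
  then have "fps_nth D v = fps_nth (W * D) v + real r * fps_nth (V * E) v"
    by (metis fps_add_nth fps_mult_left_const_nth)
  \<comment> \<open>Index \<open>i\<close> receives v - i from \<open>W * D\<close> and r i from
    \<open>V * E\<close>, together v + (r - 1) i.\<close>
  also have "\<dots> = (\<Sum>i=1..k. if i \<le> v then w i * (real v + (real r - 1) * real i) * tuple_sum k r w (v - i) else 0)"
    unfolding W_def V_def fps_mult_truncated_nth sum_distrib_left sum.distrib[symmetric]
    by (intro sum.cong) (auto simp: D_def E_def of_nat_diff algebra_simps)
  finally show ?thesis by (simp add: D_def)
qed

section \<open>Link to the mass function, geometric sums and the factored quadratic\<close>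

lemma negbin_order_pmf_eq_tuple_sum:
  assumes "0 < p"
  shows "negbin_order_pmf k r p (int (k * r) + int v)
       = p ^ (k * r) * tuple_sum k r (\<lambda>i. (1 - p) * p ^ (i - 1)) v"
proof -
  let ?w = "\<lambda>i. (1 - p) * p ^ (i - 1)"
  \<comment> \<open>As the parts sum to \<open>v\<close>, the prefactor \<open>p ^ v\<close>
    distributes over them, one \<open>p ^ i\<close> for each part of size \<open>i\<close>, and
    turns each q/p into a geometric weight.\<close>
  have w: "(\<Prod>i=1..k. ?w i ^ \<nu> i) = p ^ v * ((1 - p) / p) ^ (\<Sum>i=1..k. \<nu> i)"
    if "\<nu> \<in> weighted_tuples k v" for \<nu>
  proof -
    have "(\<Prod>i=1..k. ?w i ^ \<nu> i) = (\<Prod>i=1..k. p ^ (i * \<nu> i) * ((1 - p) / p) ^ \<nu> i)"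
    proof (rule prod.cong[OF refl])
      fix i assume "i \<in> {1..k}"
      then have "?w i = p ^ i * ((1 - p) / p)"
        using assms by (cases i) auto
      then show "?w i ^ \<nu> i = p ^ (i * \<nu> i) * ((1 - p) / p) ^ \<nu> i"
        by (simp only: power_mult_distrib power_mult)
    qed
    also have "\<dots> = p ^ (\<Sum>i=1..k. i * \<nu> i) * ((1 - p) / p) ^ (\<Sum>i=1..k. \<nu> i)"
      by (simp only: prod.distrib power_sum)
    also have "(\<Sum>i=1..k. i * \<nu> i) = v" using that by (simp add: weighted_tuples_def)
    finally show ?thesis .
  qed
  have n: "nat (int (k * r) + int v) = k * r + v" by (simp only: of_nat_add[symmetric] nat_int)
  have "p ^ v * (\<Sum>\<nu> \<in> weighted_tuples k v.
           fact ((\<Sum>i=1..k. \<nu> i) + (r - 1)) / ((\<Prod>i=1..k. fact (\<nu> i)) * fact (r - 1))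
           * ((1 - p) / p) ^ (\<Sum>i=1..k. \<nu> i)) = tuple_sum k r ?w v"
    unfolding tuple_sum_def tuple_term_def sum_distrib_left
    by (rule sum.cong[OF refl]) (simp only: w, simp)
  then show ?thesis
    unfolding negbin_order_pmf_def n by (simp only: power_add mult.assoc) simp
qed

text \<open>Grouped as in the increment formula; the last bracket is the first moment of the
  weights, later called \<open>\<mu>\<close>.\<close>

lemma mode_quadratic_factored:
  fixes k r :: nat and p v :: real
  defines "q \<equiv> 1 - p" and "t \<equiv> real r - 1"
  shows "mode_quadratic k r p v
       = (v + t) * (t * (1 - p ^ k) - q * p ^ k * (v - 1 + real k * t))
         - t * ((1 - p ^ k) / q - real k * p ^ k)"
  unfolding mode_quadratic_def Let_def q_def[symmetric] t_def[symmetric]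
  by (simp add: algebra_simps power2_eq_square)

lemma sum_truncated_geometric:
  fixes p :: "'a::comm_ring_1"
  shows "(\<Sum>i=1..k. (1 - p) * p ^ (i - 1)) = 1 - p ^ k"
  by (induction k) (simp_all add: algebra_simps)

lemma mean_truncated_geometric:
  fixes p :: real
  assumes "p \<noteq> 1"
  shows "(\<Sum>i=1..k. real i * ((1 - p) * p ^ (i - 1))) = (1 - p ^ k) / (1 - p) - real k * p ^ k"
proof (induction k)
  case (Suc k)
  have "(\<Sum>i=1..Suc k. real i * ((1 - p) * p ^ (i - 1)))
      = (1 - p ^ k) / (1 - p) - real k * p ^ k + real (Suc k) * ((1 - p) * p ^ k)"
    using Suc.IH by simp
  also have "\<dots> = (1 - p ^ Suc k) / (1 - p) - real (Suc k) * p ^ Suc k"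
    using assms by (simp add: field_simps)
  finally show ?case .
qed simp

section \<open>Recurrence and increment formulas for geometric weights\<close>

locale negbin_order =
  fixes k r :: nat and p :: real
  assumes k2: "k \<ge> 2" and r2: "r \<ge> 2" and p0: "0 < p" and p_le: "p \<le> (real r - 1) / real r"
begin

abbreviation "q \<equiv> 1 - p"
abbreviation "t \<equiv> real r - 1"
abbreviation "w i \<equiv> q * p ^ (i - 1)"
abbreviation "\<mu> \<equiv> (1 - p ^ k) / q - real k * p ^ k"
abbreviation "S \<equiv> tuple_sum k r (\<lambda>i. w i)"

text \<open>The meaning of the bound on \<open>p\<close>: since \<open>S 0 = 1\<close> and
  \<open>S 1 = q * real r\<close>, it says \<open>S 0 \<le> S 1\<close>.\<close>

lemma q_ge: "1 \<le> q * real r"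
  using p_le r2 by (simp add: field_simps)

lemma q_pos: "0 < q"
  using q_ge r2 by (smt (verit) mult_nonpos_nonneg of_nat_0_le_iff)

lemma t_ge: "1 \<le> t" using r2 by simp

lemma w_pos: "0 < w i"
  using q_pos p0 by simp

lemma \<mu>_eq: "\<mu> = (\<Sum>i=1..k. real i * w i)"
  using mean_truncated_geometric[of p k] q_pos by simp

lemma \<mu>_pos: "0 < \<mu>"
  unfolding \<mu>_eq using k2 w_pos by (intro sum_pos) auto

lemma S_rec: "real v * S v = (\<Sum>i=1..k. if i \<le> v then w i * (real v + t * real i) * S (v - i) else 0)"
  using r2 by (intro tuple_sum_rec) simp

lemma S_rec_full:
  assumes "k \<le> v"
  shows "real v * S v = (\<Sum>i=1..k. w i * (real v + t * real i) * S (v - i))"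
  unfolding S_rec[of v] using assms by (intro sum.cong) auto

lemma S_rec_short:
  assumes "v \<le> k"
  shows "real v * S v = (\<Sum>i=1..v. w i * (real v + t * real i) * S (v - i))"
proof -
  have "(\<Sum>i=1..v. w i * (real v + t * real i) * S (v - i))
      = (\<Sum>i=1..v. if i \<le> v then w i * (real v + t * real i) * S (v - i) else 0)"
    by (intro sum.cong) auto
  also have "\<dots> = (\<Sum>i=1..k. if i \<le> v then w i * (real v + t * real i) * S (v - i) else 0)"
    using assms by (intro sum.mono_neutral_left) auto
  finally show ?thesis using S_rec[of v] by simp
qed

lemma S_pos: "0 < S v"
proof (induction v rule: less_induct)
  case (less v)
  show ?case
  proof (cases "v = 0")
    case False
    have nonneg: "0 \<le> (if i \<le> v then w i * (real v + t * real i) * S (v - i) else 0)"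
      if "i \<in> {1..k}" for i
      using that less.IH[of "v - i"] p0 q_pos t_ge
      by (cases "i \<le> v") (simp_all only: if_True if_False order.refl, intro mult_nonneg_nonneg, auto)
    have "0 < w 1 * (real v + t * real 1) * S (v - 1)"
      using False less.IH[of "v - 1"] w_pos[of 1] t_ge by (intro mult_pos_pos) auto
    then have "0 < real v * S v"
      unfolding S_rec[of v] using False k2
      by (intro sum_pos2[where i = 1] nonneg) auto
    then show ?thesis by (simp add: zero_less_mult_iff)
  qed (simp add: tuple_sum_0)
qed

text \<open>Since \<open>w\<close> is geometric, subtracting \<open>p\<close> times the recurrence at \<open>v - 1\<close> from the one at \<open>v\<close>
  telescopes.\<close>

lemma increment_short:
  assumes "2 \<le> v" "v \<le> k"
  shows "(real v - 1) * (S v - S (v - 1)) = t * (\<Sum>i=1..v. w i * (1 - real i / real v) * S (v - i))"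
proof -
  obtain n where v: "v = Suc n" and n: "1 \<le> n" using assms by (cases v) auto
  define A where "A = (\<Sum>i=1..v. w i * S (v - i))"
  define T where "T = (\<Sum>i=1..v. real i * w i * S (v - i))"
  have 1: "real v * S v = real v * A + t * T"
    unfolding S_rec_short[OF assms(2)] A_def T_def sum_distrib_left sum.distrib[symmetric]
    by (intro sum.cong) (auto simp: algebra_simps)
  have head: "(\<Sum>i=2..v. f i) = (\<Sum>i=1..v. f i) - f 1" for f :: "nat \<Rightarrow> real"
    using sum.atLeast_Suc_atMost[of 1 v f] v by (simp only: numeral_2_eq_2 One_nat_def)
  have "p * (real n * S n) = (\<Sum>i=1..n. w (Suc i) * (real n + t * real i) * S (n - i))"
    unfolding S_rec_short[of n, OF order.trans[OF _ assms(2)], OF order.trans[OF le_SucI[OF order.refl] eq_refl[OF v[symmetric]]]]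
      sum_distrib_left
  proof (intro sum.cong refl)
    fix i assume "i \<in> {1..n}"
    then obtain j where "i = Suc j" by (cases i) auto
    then show "p * (w i * (real n + t * real i) * S (n - i)) = w (Suc i) * (real n + t * real i) * S (n - i)"
      by simp
  qed
  also have "\<dots> = (\<Sum>i=2..v. w i * (real n + t * (real i - 1)) * S (v - i))"
    unfolding v numeral_2_eq_2 One_nat_def sum.shift_bounds_cl_Suc_ivl by simp
  also have "\<dots> = (\<Sum>i=1..v. w i * (real n + t * (real i - 1)) * S (v - i)) - w 1 * real n * S n"
    unfolding head by (simp add: v)
  also have "(\<Sum>i=1..v. w i * (real n + t * (real i - 1)) * S (v - i))
      = (real n - t) * A + t * T"
    unfolding A_def T_def sum_distrib_left sum.distrib[symmetric]
    by (intro sum.cong) (auto simp: algebra_simps)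
  finally have "p * (real n * S n) = (real n - t) * A + t * T - q * real n * S n" by simp
  \<comment> \<open>The head split off at \<open>i = 1\<close> is \<open>q * real n * S n\<close>;
    as p + q = 1, it merges with the left side.\<close>
  then have 2: "real n * S n = (real n - t) * A + t * T" by (simp add: algebra_simps)
  have 3: "(\<Sum>i=1..v. w i * (1 - real i / real v) * S (v - i)) = A - T / real v"
    unfolding A_def T_def sum_divide_distrib sum_subtractf[symmetric]
    by (intro sum.cong) (auto simp: algebra_simps diff_divide_distrib)
  have 4: "S v = A + t * T / real v" using 1 v by (simp add: field_simps)
  have "real n * S v - real n * S n = t * (A - T / real v)"
    unfolding 2 4 using v by (simp add: field_simps)
  then show ?thesis unfolding 3 using v by (simp add: algebra_simps)
qed

text \<open>Here the shifted window overhangs at index k + 1, where the recurrence at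
  \<open>v\<close> has no term; the overhang is the negative summand absent from
  \<open>increment_short\<close>.\<close>

lemma increment_full:
  assumes "k < v"
  shows "(real v - 1) * (S v - S (v - 1)) = t * (\<Sum>i=1..k. w i * (1 - real i / real v) * S (v - i))
      - q * p ^ k * (real v - 1 + real k * t) * S (v - k - 1)"
proof -
  obtain n where v: "v = Suc n" and n: "k \<le> n" using assms by (cases v) auto
  define A where "A = (\<Sum>i=1..k. w i * S (v - i))"
  define T where "T = (\<Sum>i=1..k. real i * w i * S (v - i))"
  define L where "L = q * p ^ k * (real n + real k * t) * S (v - k - 1)"
  have 1: "real v * S v = real v * A + t * T"
    unfolding S_rec_full[OF less_imp_le[OF assms]] A_def T_def sum_distrib_left sum.distrib[symmetric]
    by (intro sum.cong) (auto simp: algebra_simps)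
  have head: "(\<Sum>i=2..Suc k. f i) = (\<Sum>i=1..Suc k. f i) - f 1" for f :: "nat \<Rightarrow> real"
    using sum.atLeast_Suc_atMost[of 1 "Suc k" f] by (simp only: numeral_2_eq_2 One_nat_def)
  have "p * (real n * S n) = (\<Sum>i=1..k. w (Suc i) * (real n + t * real i) * S (n - i))"
    unfolding S_rec_full[OF n] sum_distrib_left
  proof (intro sum.cong refl)
    fix i assume "i \<in> {1..k}"
    then obtain j where "i = Suc j" by (cases i) auto
    then show "p * (w i * (real n + t * real i) * S (n - i)) = w (Suc i) * (real n + t * real i) * S (n - i)"
      by simp
  qed
  also have "\<dots> = (\<Sum>i=2..Suc k. w i * (real n + t * (real i - 1)) * S (v - i))"
    unfolding v numeral_2_eq_2 One_nat_def sum.shift_bounds_cl_Suc_ivl by simp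
  also have "\<dots> = (\<Sum>i=1..Suc k. w i * (real n + t * (real i - 1)) * S (v - i)) - w 1 * real n * S n"
    unfolding head by (simp add: v)
  also have "(\<Sum>i=1..Suc k. w i * (real n + t * (real i - 1)) * S (v - i))
      = (\<Sum>i=1..k. w i * (real n + t * (real i - 1)) * S (v - i)) + L"
    unfolding L_def by (simp add: algebra_simps)
  also have "(\<Sum>i=1..k. w i * (real n + t * (real i - 1)) * S (v - i))
      = (real n - t) * A + t * T"
    unfolding A_def T_def sum_distrib_left sum.distrib[symmetric]
    by (intro sum.cong) (auto simp: algebra_simps)
  finally have "p * (real n * S n) = (real n - t) * A + t * T + L - q * real n * S n" by simp
  then have 2: "real n * S n = (real n - t) * A + t * T + L" by (simp add: algebra_simps)
  have 3: "(\<Sum>i=1..k. w i * (1 - real i / real v) * S (v - i)) = A - T / real v"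
    unfolding A_def T_def sum_divide_distrib sum_subtractf[symmetric]
    by (intro sum.cong) (auto simp: algebra_simps diff_divide_distrib)
  have 4: "S v = A + t * T / real v" using 1 v by (simp add: field_simps)
  have "real n * S v - real n * S n = t * (A - T / real v) - L"
    unfolding 2 4 using v by (simp add: field_simps)
  then show ?thesis unfolding 3 using v by (simp add: algebra_simps L_def)
qed

section \<open>Monotonicity of \<open>S\<close>\<close>

lemma S_1: "S 1 = q * real r"
proof -
  have "{Suc 0..Suc 0} = {1}" by auto
  then show ?thesis using S_rec_short[of 1] k2 by (simp add: tuple_sum_0)
qed

text \<open>In \<open>increment_short\<close> no factor \<open>1 - real i / real v\<close> is
  negative, and the one for \<open>i = 1\<close> is positive.\<close>

lemma S_less_short:
  assumes "2 \<le> v" "v \<le> k"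
  shows "S (v - 1) < S v"
proof -
  have "0 < (\<Sum>i=1..v. w i * (1 - real i / real v) * S (v - i))"
  proof (rule sum_pos2[where i = 1])
    show "0 < w 1 * (1 - real 1 / real v) * S (v - 1)"
      using assms w_pos[of 1] S_pos by (intro mult_pos_pos) auto
    show "0 \<le> w i * (1 - real i / real v) * S (v - i)" if "i \<in> {1..v}" for i
      using that p0 q_pos S_pos[of "v - i"] by (intro mult_nonneg_nonneg) auto
  qed (use assms in auto)
  then have "0 < (real v - 1) * (S v - S (v - 1))"
    unfolding increment_short[OF assms] using t_ge by simp
  then show ?thesis using assms by (simp add: zero_less_mult_iff)
qed

text \<open>Bounding the window \<open>S (v - k - 1), \<dots>, S (v - 2)\<close> from below by its first entry \<open>s\<close> already
  forces \<open>(v - 1) (S (v - 1) - s) \<ge> s (t \<mu> - p\<^sup>k (v - 1))\<close>. Feeding this back into the increment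
  formula produces exactly the quadratic.\<close>

lemma S_less_full:
  assumes v: "k < v"
    and mono: "\<And>i. i \<in> {1..k} \<Longrightarrow> S (v - k - 1) \<le> S (v - i)"
    and quad: "0 \<le> mode_quadratic k r p (real v)"
    and strict: "S (v - k - 1) < S (v - 2)"
  shows "S (v - 1) < S v"
proof -
  define s where "s = S (v - k - 1)"
  have v3: "3 \<le> v" using v k2 by simp
  have c: "0 \<le> w i * (1 - real i / real v)" if "i \<in> {1..k}" for i
    using that v p0 q_pos by (intro mult_nonneg_nonneg) auto
  have "real (v - 1) * S (v - 1) = (\<Sum>i=1..k. w i * (real (v - 1) + t * real i) * S (v - 1 - i))"
    using v by (intro S_rec_full) simp
  also have "\<dots> \<ge> (\<Sum>i=1..k. w i * (real (v - 1) + t * real i) * s)"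
  proof (intro sum_mono mult_left_mono)
    fix i assume i: "i \<in> {1..k}"
    show "s \<le> S (v - 1 - i)"
    \<comment> \<open>The window of \<open>v - 1\<close> is that of \<open>v\<close> moved by one:
      its last entry is \<open>s\<close> itself, the others fall under \<open>mono\<close>.\<close>
    proof (cases "i = k")
      case True then show ?thesis by (simp add: s_def)
    next
      case False
      then show ?thesis using mono[of "Suc i"] i by (simp add: s_def)
    qed
    show "0 \<le> w i * (real (v - 1) + t * real i)"
      using p0 q_pos t_ge by (intro mult_nonneg_nonneg) auto
  qed
  also have "(\<Sum>i=1..k. w i * (real (v - 1) + t * real i) * s)
      = s * (real (v - 1) * (\<Sum>i=1..k. w i) + t * (\<Sum>i=1..k. real i * w i))"
    unfolding sum_distrib_left sum.distrib[symmetric]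
    by (intro sum.cong) (auto simp: algebra_simps)
  finally have base: "s * (real (v - 1) * (1 - p ^ k) + t * \<mu>) \<le> real (v - 1) * S (v - 1)"
    unfolding sum_truncated_geometric \<mu>_eq .
  have low: "s * (t * \<mu> - p ^ k * (real v - 1)) \<le> (real v - 1) * (S (v - 1) - s)"
    using base v by (simp add: of_nat_diff algebra_simps)

  \<comment> \<open>Of the excess over \<open>s\<close> two summands are kept: \<open>i = 1\<close>,
    to be bounded by \<open>low\<close>, and \<open>i = 2\<close>, which makes the inequality
    strict.\<close>
  let ?d = "\<lambda>i. w i * (1 - real i / real v) * (S (v - i) - s)"
  have "(\<Sum>i\<in>{1, 2}. ?d i) \<le> (\<Sum>i=1..k. ?d i)"
  proof (rule sum_mono2)
    show "0 \<le> ?d i" if "i \<in> {1..k} - {1, 2}" for i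
      using mult_nonneg_nonneg[OF c[of i], of "S (v - i) - s"] mono[of i] that by (simp add: s_def)
  qed (use k2 in auto)
  moreover have "0 < ?d 2"
    using v3 strict p0 q_pos by (intro mult_pos_pos) (auto simp: s_def)
  ultimately have "?d 1 < (\<Sum>i=1..k. ?d i)" by simp
  also have "\<dots> = (\<Sum>i=1..k. w i * (1 - real i / real v) * S (v - i))
      - s * ((\<Sum>i=1..k. w i) - (\<Sum>i=1..k. real i * w i) / real v)"
    unfolding sum_distrib_left sum_divide_distrib sum_subtractf[symmetric]
    by (intro sum.cong) (auto simp: algebra_simps diff_divide_distrib)
  finally have gt: "q * (1 - 1 / real v) * (S (v - 1) - s) + s * (1 - p ^ k - \<mu> / real v)
      < (\<Sum>i=1..k. w i * (1 - real i / real v) * S (v - i))"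
    unfolding sum_truncated_geometric \<mu>_eq by simp
  have q\<mu>: "q * \<mu> = 1 - p ^ k - q * real k * p ^ k"
    using q_pos by (simp add: field_simps)
  have vpos: "0 < real v" using v by simp
  \<comment> \<open>The origin of the quadratic: the right side is
    \<open>v (v - 1) (S v - S (v - 1))\<close> with the bounds \<open>gt\<close> and then
    \<open>low\<close> inserted; the chain below retraces these insertions backwards.\<close>
  have "s * mode_quadratic k r p (real v)
      = t * q * (s * (t * \<mu> - p ^ k * (real v - 1))) + t * s * (real v * (1 - p ^ k) - \<mu>)
        - real v * (q * p ^ k * (real v - 1 + real k * t) * s)"
  proof -
    have "t * q * (s * (t * \<mu> - p ^ k * (real v - 1))) = t * s * (t * (q * \<mu>) - q * p ^ k * (real v - 1))"
      by (simp only: algebra_simps)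
    then show ?thesis
      unfolding mode_quadratic_factored q\<mu> by (simp add: algebra_simps)
  qed
  also have "\<dots> \<le> t * q * ((real v - 1) * (S (v - 1) - s)) + t * s * (real v * (1 - p ^ k) - \<mu>)
        - real v * (q * p ^ k * (real v - 1 + real k * t) * s)"
    using low t_ge q_pos by (intro diff_right_mono add_right_mono mult_left_mono) auto
  also have "\<dots> = real v * (t * (q * (1 - 1 / real v) * (S (v - 1) - s) + s * (1 - p ^ k - \<mu> / real v))
        - q * p ^ k * (real v - 1 + real k * t) * s)"
  proof -
    define m where "m = \<mu>"
    show ?thesis unfolding m_def[symmetric] using vpos by (simp add: field_simps)
  qed
  also have "\<dots> < real v * (t * (\<Sum>i=1..k. w i * (1 - real i / real v) * S (v - i))
        - q * p ^ k * (real v - 1 + real k * t) * s)"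
    using gt t_ge vpos by (intro mult_strict_left_mono diff_strict_right_mono) auto
  also have "\<dots> = real v * ((real v - 1) * (S v - S (v - 1)))"
    unfolding increment_full[OF v] s_def ..
  finally have "s * mode_quadratic k r p (real v) < real v * ((real v - 1) * (S v - S (v - 1)))" .
  moreover have "0 \<le> s * mode_quadratic k r p (real v)"
    using quad S_pos[of "v - k - 1"] by (simp add: s_def)
  ultimately have "0 < real v * ((real v - 1) * (S v - S (v - 1)))" by linarith
  then show ?thesis using v3 by (simp add: zero_less_mult_iff)
qed

text \<open>For \<open>x > 1\<close>, splitting off the root \<open>x\<close> leaves a linear factor
  that increases with its argument; it is nonnegative at 1, hence at \<open>v\<close>.\<close>

lemma mode_quadratic_nonneg:
  assumes root: "mode_quadratic k r p x = 0" and v: "1 \<le> v" "v \<le> x"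
  shows "0 \<le> mode_quadratic k r p v"
proof (cases "1 < x")
  case True
  define a where "a = q * p ^ k"
  define b where "b = p ^ k * (q - (real k * q + q + 1) * t) + t"
  have a: "0 < a" using q_pos p0 by (simp add: a_def)
  have f: "mode_quadratic k r p u = (x - u) * (a * (u + x) - b)" for u
  proof -
    have "mode_quadratic k r p u = mode_quadratic k r p u - mode_quadratic k r p x" using root by simp
    also have "\<dots> = (- a * u\<^sup>2 + b * u) - (- a * x\<^sup>2 + b * x)"
      unfolding mode_quadratic_def Let_def a_def b_def by (simp add: algebra_simps)
    also have "\<dots> = (x - u) * (a * (u + x) - b)" by (simp add: algebra_simps power2_eq_square)
    finally show ?thesis .
  qed
  \<comment> \<open>The factor \<open>real r * q - 1\<close> is \<open>S 1 - S 0\<close>, so the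
    sign at 1 is settled by the bound on \<open>p\<close>.\<close>
  have "mode_quadratic k r p 1 = t * (\<mu> * (real r * q - 1))"
  proof -
    have q\<mu>: "\<mu> * q = 1 - p ^ k - q * real k * p ^ k" using q_pos by (simp add: field_simps)
    have "t * (\<mu> * (real r * q - 1)) = t * (real r * (\<mu> * q) - \<mu>)" by (simp only: algebra_simps)
    then show ?thesis unfolding mode_quadratic_factored q\<mu> by (simp add: algebra_simps)
  qed
  also have "\<dots> \<ge> 0"
    using t_ge \<mu>_pos q_ge by (intro mult_nonneg_nonneg) (auto simp: mult.commute)
  finally have "0 \<le> a * (1 + x) - b"
    using f[of 1] True by (simp add: zero_le_mult_iff)
  also have "\<dots> \<le> a * (v + x) - b" using a v by simp
  finally show ?thesis unfolding f using v by simp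
next
  case False
  then have "v = x" using v by simp
  then show ?thesis using root by simp
qed

text \<open>By strong induction the earlier steps supply the monotone window for
  \<open>S_less_full\<close>. The excluded triple concerns the strict rise inside that window when
  \<open>k = 2\<close> and \<open>v = 3\<close>.\<close>

lemma S_less:
  assumes excl: "\<not> (k = 2 \<and> r = 2 \<and> p = 1/2)"
    and root: "mode_quadratic k r p x = 0"
    and v: "2 \<le> v" "v \<le> k \<or> real v \<le> x"
  shows "S (v - 1) < S v"
  using v
proof (induction v rule: less_induct)
  case (less v)
  show ?case
  proof (cases "v \<le> k")
    case True
    then show ?thesis using S_less_short less.prems by blast
  next
    case False
    then have v: "k < v" and vx: "real v \<le> x" using less.prems by auto
    have quad: "0 \<le> mode_quadratic k r p (real v)"
      using mode_quadratic_nonneg[OF root] v vx by simp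
    have step: "S (u - 1) < S u" if "2 \<le> u" "u < v" for u
      using less.IH[of u] that vx by linarith
    have step': "S n \<le> S (Suc n)" if "Suc n < v" for n
    proof (cases n)
      case 0
      then show ?thesis using S_1 q_ge by (simp add: tuple_sum_0)
    next
      case (Suc j)
      then show ?thesis using step[of "Suc n"] that by simp
    qed
    have mono: "S m \<le> S n" if "m \<le> n" "n < v" for m n
      using that by (induction n rule: dec_induct) (use step' in force)+
    have strict: "S (v - k - 1) < S (v - 2)"
    proof (cases "v = Suc k \<and> k = 2")
      case True
      \<comment> \<open>Here the claim is \<open>S 0 < S 1\<close>. Equality would make the
        quadratic at 3 equal to (r - 1)(4 - 2r)/r^2, which is nonnegative only for r = 2; then p =
        1/2, the excluded triple.\<close>
      have "q * real r \<noteq> 1"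
      proof
        assume qr: "q * real r = 1"
        define y where "y = real r"
        have y: "2 \<le> y" "y \<noteq> 0" using r2 by (auto simp: y_def)
        have p: "p = 1 - 1 / y" using qr y by (simp add: y_def field_simps)
        have qq: "1 - p = 1 / y" using p by simp
        have "mode_quadratic 2 r p 3 = (y - 1) * (4 - 2 * y) / y\<^sup>2"
          unfolding mode_quadratic_def Let_def y_def[symmetric] qq
          unfolding p using y by (simp add: field_simps power2_eq_square)
        then have "0 \<le> (y - 1) * (4 - 2 * y)" using quad True y
          by (simp add: zero_le_divide_iff)
        then have "y = 2" using y by (simp add: zero_le_mult_iff)
        then show False using excl True p by (simp add: y_def)
      qed
      then show ?thesis using True S_1 q_ge by (simp add: tuple_sum_0)
    next
      case False
      \<comment> \<open>A strict step from \<open>u - 1\<close> to \<open>u\<close> inside the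
        window. It needs \<open>u \<ge> 2\<close> because \<open>S 0 = S 1\<close> is possible; for
        \<open>v = Suc k\<close> it fits since then \<open>k \<ge> 3\<close>.\<close>
      define u where "u = (if v - k \<ge> 2 then v - k else 2)"
      have u: "2 \<le> u" "v - k \<le> u" "u \<le> v - 2"
        using False v k2 by (auto simp: u_def)
      have "S (v - k - 1) \<le> S (u - 1)" using u v by (intro mono) auto
      also have "\<dots> < S u" using u v by (intro step) auto
      also have "\<dots> \<le> S (v - 2)" using u v by (intro mono) auto
      finally show ?thesis .
    qed
    have "S (v - k - 1) \<le> S (v - i)" if "i \<in> {1..k}" for i
      using that v by (intro mono) auto
    then show ?thesis by (rule S_less_full[OF v _ quad strict])
  qed
qed

end

section \<open>From the increase of \<open>S\<close> to the location of the modes\<close>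

theorem theorem2p2:
  fixes k r :: nat and p v2 \<rho> :: real and m :: int
  assumes "k \<ge> 2" and "r \<ge> 2"
    and "0 < p" and "p \<le> (real r - 1) / real r"
    and "\<not> (k = 2 \<and> r = 2 \<and> p = 1/2)"
    and "is_largest_root (mode_quadratic k r p) v2"
    and "\<rho> = (if v2 > real k then v2 else real k)"
    and "is_mode (negbin_order_pmf k r p) m"
  shows "m \<ge> int (k * r) + \<lfloor>\<rho>\<rfloor>"
proof (rule ccontr)
  assume neg: "\<not> ?thesis"
  interpret negbin_order k r p using assms(1-4) by unfold_locales
  have root: "mode_quadratic k r p v2 = 0" using assms(6) by (simp add: is_largest_root_def)
  define L where "L = nat \<lfloor>\<rho>\<rfloor>"
  have \<rho>: "real k \<le> \<rho>" using assms(7) by simp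
  then have kL: "k \<le> L" by (simp add: L_def le_nat_iff le_floor_iff)
  have L: "int L = \<lfloor>\<rho>\<rfloor>" using \<rho> by (simp add: L_def)
  have L\<rho>: "real L \<le> \<rho>" using L by linarith
  have step: "S n < S (Suc n)" if "1 \<le> n" "Suc n \<le> L" for n
    using S_less[OF assms(5) root, of "Suc n"] that L\<rho> assms(7) by (auto split: if_splits)
  have step0: "S 0 \<le> S 1" using S_1 q_ge by (simp add: tuple_sum_0)
  have mono: "S j \<le> S n" if "j \<le> n" "n \<le> L" for j n
    using that
  proof (induction n rule: dec_induct)
    case (step n)
    then show ?case using \<open>\<And>n. 1 \<le> n \<Longrightarrow> Suc n \<le> L \<Longrightarrow> S n < S (Suc n)\<close>[of n] step0
      by (cases "n = 0") auto
  qed simp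
  \<comment> \<open>As \<open>L \<ge> 2\<close>, the final step from \<open>L - 1\<close> to
    \<open>L\<close> is strict, whether or not \<open>S 0 = S 1\<close>.\<close>
  have less: "S u < S L" if "u < L" for u
  proof -
    have "S u \<le> S (L - 1)" using that by (intro mono) auto
    also have "\<dots> < S L" using step[of "L - 1"] kL k2 by simp
    finally show ?thesis .
  qed
  \<comment> \<open>The assumed mode lies below kr + L, so a strictly larger value there contradicts
    maximality.\<close>
  have "negbin_order_pmf k r p m < negbin_order_pmf k r p (int (k * r) + int L)"
  proof (cases "m < int (k * r)")
    case True
    then have "negbin_order_pmf k r p m = 0" by (simp add: negbin_order_pmf_def)
    then show ?thesis
      unfolding negbin_order_pmf_eq_tuple_sum[OF p0] using p0 S_pos[of L] by simp
  next
    case False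
    define u where "u = nat (m - int (k * r))"
    have m: "m = int (k * r) + int u" using False by (simp add: u_def)
    have "u < L" using neg L m by linarith
    then show ?thesis
      unfolding m negbin_order_pmf_eq_tuple_sum[OF p0] using p0 less by simp
  qed
  then show False using assms(8) by (simp add: is_mode_def not_le[symmetric])
qed

end
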